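(* Let $G$ be a connected graph of order $n$, minimum degree $\delta\geq 2$ and vertex-connectivity $\kappa$. If $n\geq \delta^2-2\delta+7$ and $\rho(G) \geq n-3$, then $\kappa=\delta$, unless $G\cong K_{\delta-1}\vee (K_2\cup K_{n-\delta-1})$.
   Context: All graphs are finite, simple and undirected. $\rho(G)$ denotes the spectral radius (largest eigenvalue) of the adjacency matrix of $G$. The vertex-connectivity $\kappa(G)$ of a connected non-complete graph is the minimum size of a vertex set whose removal disconnects $G$, and $\kappa(K_n)=n-1$. $K_r$ is the complete graph on $r$ vertices, $\cup$ is disjoint union and $G_1\vee G_2$ is the join (disjoint union plus all edges between $G_1$ and $G_2$). *)

theory Defs
  imports
    "Jordan_Normal_Form.Spectral_Radius"
    "Graph_Theory.Graph_Theory"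
begin

text \<open>
  A finite simple undirected graph is a symmetric loopfree finite digraph whose arcs are pairs
  of vertices, i.e. the locale \<^locale>\<open>pair_graph\<close>; the edge \<open>uv\<close> is represented by the two
  arcs \<open>(u, v)\<close> and \<open>(v, u)\<close>. Hence the out-degree of a vertex is its number of neighbours.
\<close>

definition min_degree :: "'a pair_pre_digraph \<Rightarrow> nat" where
  "min_degree G = Min (out_degree (with_proj G) ` pverts G)"

text \<open>
  The library's \<^const>\<open>Digraph_Component.connected\<close> is false for the graph without vertices,
  so only proper subsets of the vertex set are admitted as separating sets. For a non-complete
  graph there is at least one: all vertices except two non-adjacent ones.
\<close>

definition vertex_connectivity :: "'a pair_pre_digraph \<Rightarrow> nat" where
  "vertex_connectivity G =
     (if complete_digraph (card (pverts G)) (with_proj G) then card (pverts G) - 1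
      else Min (card ` {S. S \<subset> pverts G \<and>
             \<not> Digraph_Component.connected (with_proj G \<restriction> (pverts G - S))}))"

definition adjacency_matrix :: "'a pair_pre_digraph \<Rightarrow> 'a list \<Rightarrow> complex mat" where
  "adjacency_matrix G vs =
     mat (length vs) (length vs) (\<lambda>(i, j). if (vs ! i, vs ! j) \<in> parcs G then 1 else 0)"

text \<open>
  The vertices are enumerated in an arbitrary order; another order gives a similar matrix, with
  the same spectrum. The library's \<^const>\<open>spectral_radius\<close> is the largest modulus of a complex
  eigenvalue. The adjacency matrix being symmetric and nonnegative, this is its largest
  eigenvalue.
\<close>

definition graph_spectral_radius :: "'a pair_pre_digraph \<Rightarrow> real" where
  "graph_spectral_radius G =
     spectral_radius (adjacency_matrix G (SOME vs. distinct vs \<and> set vs = pverts G))"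

definition complete_graph :: "nat \<Rightarrow> nat pair_pre_digraph" where
  "complete_graph r = \<lparr> pverts = {..<r}, parcs = {(u, v). u < r \<and> v < r \<and> u \<noteq> v} \<rparr>"

definition disjoint_union ::
    "'a pair_pre_digraph \<Rightarrow> 'b pair_pre_digraph \<Rightarrow> ('a + 'b) pair_pre_digraph" where
  "disjoint_union G H =
     \<lparr> pverts = pverts G <+> pverts H,
       parcs = map_prod Inl Inl ` parcs G \<union> map_prod Inr Inr ` parcs H \<rparr>"

definition graph_join ::
    "'a pair_pre_digraph \<Rightarrow> 'b pair_pre_digraph \<Rightarrow> ('a + 'b) pair_pre_digraph" where
  "graph_join G H =
     \<lparr> pverts = pverts (disjoint_union G H),
       parcs = parcs (disjoint_union G H)
         \<union> (Inl ` pverts G) \<times> (Inr ` pverts H) \<union> (Inr ` pverts H) \<times> (Inl ` pverts G) \<rparr>"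

lemma complete_digraph_complete_graph:
  "complete_digraph r (with_proj (complete_graph r))"
  unfolding complete_digraph_pair_def by (auto simp: complete_graph_def)

end

theory Submission
  imports Defs
begin

text \<open>
  If a positive vector \<open>y\<close> satisfies \<open>A y < c y\<close> entrywise, where \<open>A\<close> is the adjacency matrix, then
  \<open>\<rho>(G) < c\<close>. Suppose \<open>\<kappa> < \<delta>\<close> and let \<open>S\<close> be a minimum separating set, with no edges between the two
  sides \<open>A\<close> and \<open>B\<close>. The degrees of the vertices in \<open>A\<close> and \<open>B\<close> force both sides to have at least two
  vertices. If both have at least three, a vector that is constant on each of \<open>A\<close>, \<open>B\<close>, \<open>S\<close> shows
  \<open>\<rho>(G) < n - 3\<close>. If \<open>|A| = 2\<close>, then \<open>|S| = \<delta> - 1\<close> and the degrees force all edges inside \<open>A\<close> and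
  between \<open>A\<close> and \<open>S\<close>. A missing edge \<open>uv\<close> inside \<open>S \<union> B\<close> again yields \<open>\<rho>(G) < n - 3\<close>, with a vector
  that is \<open>\<alpha>\<close> on \<open>A\<close>, \<open>1\<close> on \<open>B\<close> and \<open>1 + \<sigma>\<close> on \<open>S\<close>, lowered by \<open>\<zeta>\<close> at \<open>u\<close> and \<open>v\<close>;
  without a missing edge \<open>G\<close> is the exceptional graph.
\<close>

section \<open>Upper bounds for the spectral radius\<close>

text \<open>Collatz-Wielandt argument. For an eigenvector \<open>v\<close> of an eigenvalue of
  largest modulus, choose \<open>i\<close> maximising \<open>cmod (v $ i) / y i\<close>. Every
  \<open>cmod (v $ j)\<close> is then at most that ratio times \<open>y j\<close>, so the triangle
  inequality in row \<open>i\<close> and the supersolution property bound the modulus.\<close>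

lemma spectral_radius_less_if_supersolution:
  fixes A :: "complex mat" and y :: "nat \<Rightarrow> real"
  assumes A: "A \<in> carrier_mat n n" and n: "n > 0"
    and y: "\<And>i. i < n \<Longrightarrow> y i > 0"
    and super: "\<And>i. i < n \<Longrightarrow> (\<Sum>j<n. cmod (A $$ (i, j)) * y j) < c * y i"
  shows "spectral_radius A < c"
proof -
  from spectral_radius_mem_max(1)[OF A n] obtain \<mu> v
    where \<rho>: "spectral_radius A = cmod \<mu>" and ev: "eigenvector A v \<mu>"
    unfolding spectrum_def eigenvalue_def by auto
  then have v: "v \<in> carrier_vec n" "v \<noteq> 0\<^sub>v n" and Av: "A *\<^sub>v v = \<mu> \<cdot>\<^sub>v v"
    using A unfolding eigenvector_def by auto
  define r where "r i = cmod (v $ i) / y i" for i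
  have "r ` {..<n} \<noteq> {}" using n by auto
  then have "Max (r ` {..<n}) \<in> r ` {..<n}" by simp
  then obtain i where i: "i < n" and ri: "r i = Max (r ` {..<n})" by auto
  have max: "cmod (v $ j) \<le> r i * y j" if "j < n" for j
  proof -
    have "r j \<le> r i" unfolding ri using that by simp
    then show ?thesis using y[OF that] by (simp add: r_def[of j] pos_divide_le_eq)
  qed
  have vi: "cmod (v $ i) = r i * y i" using y[OF i] by (simp add: r_def)
  \<comment> \<open>Needed to scale the strict inequality by \<open>r i\<close>: if the largest
    ratio were not positive, every entry of \<open>v\<close> would vanish.\<close>
  have "r i > 0"
  proof (rule ccontr)
    assume "\<not> r i > 0"
    then have "cmod (v $ j) \<le> 0" if "j < n" for j
      using max[OF that] y[OF that] by (meson linorder_not_less mult_nonpos_nonneg order.trans less_imp_le)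
    then have "v = 0\<^sub>v n" using v(1) by (intro eq_vecI) auto
    then show False using v(2) by simp
  qed
  have "\<mu> * v $ i = (\<Sum>j<n. A $$ (i, j) * v $ j)"
    using arg_cong[OF Av, of "\<lambda>w. w $ i"] A v(1) i
    by (simp add: scalar_prod_def atLeast0LessThan)
  then have "cmod \<mu> * cmod (v $ i) \<le> (\<Sum>j<n. cmod (A $$ (i, j)) * cmod (v $ j))"
    by (metis (no_types, lifting) norm_mult norm_sum sum.cong)
  also have "\<dots> \<le> (\<Sum>j<n. cmod (A $$ (i, j)) * (r i * y j))"
    by (intro sum_mono mult_left_mono max) auto
  also have "\<dots> = r i * (\<Sum>j<n. cmod (A $$ (i, j)) * y j)"
    by (simp add: sum_distrib_left mult_ac)
  also have "\<dots> < r i * (c * y i)"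
    using super[OF i] \<open>r i > 0\<close> by simp
  also have "\<dots> = c * cmod (v $ i)" by (simp add: vi)
  finally have "cmod \<mu> < c"
    using vi \<open>r i > 0\<close> y[OF i] by simp
  then show ?thesis by (simp add: \<rho>)
qed

text \<open>Whatever enumeration is chosen, the matrix row of a vertex applied to \<open>y\<close>
  is the sum of \<open>y\<close> over its neighbours.\<close>

lemma graph_spectral_radius_less_if_supersolution:
  fixes y :: "'a \<Rightarrow> real"
  assumes "pair_graph G" and "pverts G \<noteq> {}"
    and y: "\<And>v. v \<in> pverts G \<Longrightarrow> y v > 0"
    and super: "\<And>v. v \<in> pverts G \<Longrightarrow> sum y (parcs G `` {v}) < c * y v"
  shows "graph_spectral_radius G < c"
proof -
  interpret pair_graph G by fact
  define vs where "vs = (SOME vs. distinct vs \<and> set vs = pverts G)"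
  have "\<exists>vs. distinct vs \<and> set vs = pverts G"
    using finite_distinct_list[OF pair_finite_verts] by blast
  from someI_ex[OF this] have vs: "distinct vs" "set vs = pverts G"
    unfolding vs_def by auto
  have "spectral_radius (adjacency_matrix G vs) < c"
  proof (rule spectral_radius_less_if_supersolution)
    show "adjacency_matrix G vs \<in> carrier_mat (length vs) (length vs)"
      by (simp add: adjacency_matrix_def)
    show "length vs > 0" using vs(2) \<open>pverts G \<noteq> {}\<close> by auto
    fix i assume i: "i < length vs"
    then have mem: "vs ! i \<in> pverts G" using vs(2) nth_mem by blast
    then show "y (vs ! i) > 0" by (rule y)
    have "(\<Sum>j<length vs. cmod (adjacency_matrix G vs $$ (i, j)) * y (vs ! j))
        = (\<Sum>j<length vs. if (vs ! i, vs ! j) \<in> parcs G then y (vs ! j) else 0)"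
      using i by (intro sum.cong) (auto simp: adjacency_matrix_def)
    also have "\<dots> = (\<Sum>w\<in>pverts G. if (vs ! i, w) \<in> parcs G then y w else 0)"
      by (rule sum.reindex_bij_betw) (use bij_betw_nth[OF vs(1) refl] vs(2) in auto)
    also have "\<dots> = (\<Sum>w\<in>{w \<in> pverts G. (vs ! i, w) \<in> parcs G}. y w)"
      by (rule sum.inter_filter[symmetric]) (rule pair_finite_verts)
    also have "{w \<in> pverts G. (vs ! i, w) \<in> parcs G} = parcs G `` {vs ! i}"
      using in_arcsD2 by auto
    also have "sum y \<dots> < c * y (vs ! i)" by (rule super[OF mem])
    finally show "(\<Sum>j<length vs. cmod (adjacency_matrix G vs $$ (i, j)) * y (vs ! j))
      < c * y (vs ! i)" .
  qed
  then show ?thesis by (simp add: graph_spectral_radius_def vs_def)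
qed

section \<open>Connectedness, degrees and isomorphism\<close>

lemma out_degree_with_proj: "out_degree (with_proj G) v = card (parcs G `` {v})"
proof -
  have "out_arcs (with_proj G) v = Pair v ` (parcs G `` {v})"
    by (auto simp: out_arcs_def)
  then show ?thesis by (simp add: out_degree_def card_image inj_on_def)
qed

text \<open>Arcs are pairs of vertices, so the vertex map determines the arc map
  \<open>map_prod f f\<close>. Since the arcs of \<open>H\<close> have their ends in the image of
  \<open>f\<close>, the arc map is onto.\<close>

lemma digraph_iso_with_projI:
  assumes "wf_digraph (with_proj G)"
    and f: "bij_betw f (pverts G) (pverts H)" and H: "parcs H \<subseteq> pverts H \<times> pverts H"
    and arcs: "\<And>u v. u \<in> pverts G \<Longrightarrow> v \<in> pverts G \<Longrightarrow> (f u, f v) \<in> parcs H \<longleftrightarrow> (u, v) \<in> parcs G"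
  shows "digraph_iso (with_proj G) (with_proj H)"
proof -
  interpret wf_digraph "with_proj G" by fact
  let ?f = "\<lparr> iso_verts = f, iso_arcs = map_prod f f, iso_head = snd, iso_tail = fst \<rparr>"
  have "inj_on f (pverts G)" using f by (rule bij_betw_imp_inj_on)
  have G: "parcs G \<subseteq> pverts G \<times> pverts G"
    using tail_in_verts head_in_verts by auto
  with \<open>inj_on f (pverts G)\<close> have "inj_on (map_prod f f) (parcs G)"
    using map_prod_inj_on inj_on_subset by blast
  with \<open>inj_on f (pverts G)\<close> have "digraph_isomorphism ?f"
    by (simp add: digraph_isomorphism_def wf_digraph)
  moreover have "parcs H = map_prod f f ` parcs G"
  proof
    show "map_prod f f ` parcs G \<subseteq> parcs H" using G arcs by auto
    show "parcs H \<subseteq> map_prod f f ` parcs G"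
    proof (clarify)
      fix p q assume pq: "(p, q) \<in> parcs H"
      with H f obtain u v where "u \<in> pverts G" "v \<in> pverts G" "p = f u" "q = f v"
        unfolding bij_betw_def by blast
      with pq arcs show "(p, q) \<in> map_prod f f ` parcs G" by (auto simp: rev_image_eqI)
    qed
  qed
  then have "with_proj H = app_iso ?f (with_proj G)"
    using f by (simp add: app_iso_def with_proj_def bij_betw_imp_surj_on)
  ultimately show ?thesis unfolding digraph_iso_def by blast
qed

lemma parcs_disjoint_union:
  "(Inl x, Inl x') \<in> parcs (disjoint_union G H) \<longleftrightarrow> (x, x') \<in> parcs G"
  "(Inr y, Inr y') \<in> parcs (disjoint_union G H) \<longleftrightarrow> (y, y') \<in> parcs H"
  "(Inl x, Inr y) \<notin> parcs (disjoint_union G H)"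
  "(Inr y, Inl x) \<notin> parcs (disjoint_union G H)"
  by (auto simp: disjoint_union_def)

lemma parcs_graph_join:
  "(Inl x, Inl x') \<in> parcs (graph_join G H) \<longleftrightarrow> (x, x') \<in> parcs G"
  "(Inr y, Inr y') \<in> parcs (graph_join G H) \<longleftrightarrow> (y, y') \<in> parcs H"
  "(Inl x, Inr y) \<in> parcs (graph_join G H) \<longleftrightarrow> x \<in> pverts G \<and> y \<in> pverts H"
  "(Inr y, Inl x) \<in> parcs (graph_join G H) \<longleftrightarrow> x \<in> pverts G \<and> y \<in> pverts H"
  by (auto simp: graph_join_def parcs_disjoint_union)

text \<open>Turns failure of connectedness into a set \<open>A\<close> with no arc to the rest,
  which serves as one side of a separation. Arcs are symmetric, so directed reachability suffices: a
  set that no arc leaves contains all that it reaches, and conversely the set reachable from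
  \<open>u\<close> is such a set.\<close>

lemma connected_induce_subgraph_iff:
  assumes "pair_graph G"
  shows "Digraph_Component.connected (with_proj G \<restriction> U) \<longleftrightarrow>
    U \<noteq> {} \<and> (\<forall>A \<subseteq> U. A \<noteq> {} \<longrightarrow> parcs G \<inter> A \<times> (U - A) = {} \<longrightarrow> A = U)"
    (is "?l \<longleftrightarrow> ?r")
proof -
  interpret pair_graph G by fact
  have symm: "sym (parcs G)" using pair_sym_arcs by (simp add: symmetric_def)
  have ends: "arcs_ends (with_proj G \<restriction> U) = parcs G \<inter> U \<times> U"
    by (auto simp: arcs_ends_conv induce_subgraph_def)
  have cl: "symcl (parcs G \<inter> U \<times> U) = parcs G \<inter> U \<times> U"
    using symm by (auto simp: symcl_def sym_def)
  have conn: "?l \<longleftrightarrow> U \<noteq> {} \<and> (\<forall>u\<in>U. \<forall>v\<in>U. (u, v) \<in> rtrancl_on U (parcs G \<inter> U \<times> U))"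
    unfolding connected_conv ends cl by simp
  show ?thesis
  proof
    assume ?l
    show ?r
    proof (intro conjI allI impI)
      show "U \<noteq> {}" using \<open>?l\<close> conn by blast
      fix A assume A: "A \<subseteq> U" "A \<noteq> {}" "parcs G \<inter> A \<times> (U - A) = {}"
      then obtain u where u: "u \<in> A" by blast
      have "v \<in> A" if "v \<in> U" for v
      proof -
        have "(u, v) \<in> rtrancl_on U (parcs G \<inter> U \<times> U)"
          using \<open>?l\<close> conn u A(1) that by blast
        then show ?thesis
          by (induction rule: rtrancl_on_induct) (use u A(3) in auto)
      qed
      then show "A = U" using A(1) by blast
    qed
  next
    assume r: ?r
    show ?l
      unfolding conn
    proof (intro conjI ballI)
      show "U \<noteq> {}" using r by blast
      fix u v assume uv: "u \<in> U" "v \<in> U"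
      let ?A = "{w. (u, w) \<in> rtrancl_on U (parcs G \<inter> U \<times> U)}"
      have "?A \<subseteq> U" by (auto dest: in_rtrancl_on_in_F)
      moreover have "?A \<noteq> {}" using uv by auto
      moreover have "parcs G \<inter> ?A \<times> (U - ?A) = {}"
        using \<open>?A \<subseteq> U\<close> by (auto intro: rtrancl_on_into_rtrancl_on)
      ultimately have "?A = U" using r by blast
      then show "(u, v) \<in> rtrancl_on U (parcs G \<inter> U \<times> U)" using uv by blast
    qed
  qed
qed

section \<open>Weights for the two test vectors\<close>

text \<open>With weight \<alpha> on a side of size \<open>a\<close>, \<beta> on a side of size
  \<open>b\<close> and 1 on \<open>s\<close> separating vertices, the last three inequalities are
  the supersolution conditions for \<open>c = a + b + s - 3\<close> when all permitted edges are
  present.\<close>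

lemma two_sided_weights:
  fixes a b s :: nat
  assumes "3 \<le> a" "3 \<le> b" "s\<^sup>2 + 6 \<le> a + b + s"
  obtains \<alpha> \<beta> :: real where "\<alpha> > 0" "\<beta> > 0"
    "s < (real b + s - 2) * \<alpha>" "s < (real a + s - 2) * \<beta>" "a * \<alpha> + b * \<beta> < real a + b - 2"
proof -
  \<comment> \<open>With equality in the lower bounds, \<open>\<alpha> = s / (b + s - 2)\<close> and
    \<open>\<beta> = s / (a + s - 2)\<close>, the third inequality must still be strict. By symmetry
    \<open>a \<le> b\<close> may be assumed.\<close>
  have key: "s * (a / (real b + s - 2) + b / (real a + s - 2)) < real a + b - 2"
    if a3: "3 \<le> a" and ab: "a \<le> b" and n: "s\<^sup>2 + 6 \<le> a + b + s" for a b :: nat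
  proof -
    \<comment> \<open>No integer lies strictly between 1 and 2. Hence
      \<open>s^2 \<ge> 3 * s - 2\<close>, and the size hypothesis with \<open>a \<le> b\<close>
      gives \<open>b \<ge> s + 2\<close>.\<close>
    have "(real s - 1) * (real s - 2) \<ge> 0"
      by (cases "s \<le> 1") (auto simp: mult_nonpos_nonpos)
    moreover have "real s ^ 2 + 6 \<le> 2 * b + s"
      using of_nat_mono[OF n, where ?'a = real] ab by simp
    ultimately have b: "real b \<ge> real s + 2"
      by (simp add: power2_eq_square algebra_simps)
    have a: "real a \<ge> 3" "real b \<ge> 3" using a3 ab by simp_all
    \<comment> \<open>The amount by which the left side of the claim falls short of
      \<open>a + b\<close> splits into a part from \<open>a\<close>, at least 3/2, and a part from
      \<open>b\<close>, at least 1. The total 5/2 exceeds the required 2.\<close>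
    have "real a * (real b - 2) \<ge> 3 * (real b - 2)" using a b by (intro mult_right_mono) auto
    then have "real a * (real b - 2) / (real b + s - 2) \<ge> 3 / 2"
      using a b by (subst pos_le_divide_eq) auto
    moreover have "real a - s * (a / (real b + s - 2)) = real a * (real b - 2) / (real b + s - 2)"
      using a b by (simp add: field_simps)
    moreover have "real b * (real a - 2) / (real a + s - 2) \<ge> 1"
    proof -
      have "real b * (real a - 2) \<ge> (real s + 2) * (real a - 2)" using a b by (intro mult_right_mono) auto
      moreover have "real s * (real a - 2) \<ge> real s * 1" using a by (intro mult_left_mono) auto
      ultimately show ?thesis using a by (simp add: field_simps)
    qed
    moreover have "real b - s * (b / (real a + s - 2)) = real b * (real a - 2) / (real a + s - 2)"
      using a by (simp add: field_simps)
    ultimately show ?thesis unfolding distrib_left by linarith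
  qed
  define p q where "p = 1 / (real b + s - 2)" and "q = 1 / (real a + s - 2)"
  define K where "K = a * p + b * q"
  have "real a \<ge> 3" "real b \<ge> 3" using assms by simp_all
  then have pq: "p > 0" "q > 0" "(real b + s - 2) * p = 1" "(real a + s - 2) * q = 1"
    by (simp_all add: p_def q_def)
  then have "K > 0" unfolding K_def using assms by (intro add_pos_pos mult_pos_pos) auto
  have sK: "s * K < real a + b - 2"
  proof (cases "a \<le> b")
    case True
    then show ?thesis using key[of a b] assms by (simp add: K_def p_def q_def)
  next
    case False
    then show ?thesis using key[of b a] assms by (simp add: K_def p_def q_def add_ac)
  qed
  \<comment> \<open>Replacing \<open>s\<close> by \<open>s + \<epsilon>\<close> makes both lower
    bounds strict and spends only half of the slack in the third inequality.\<close>
  define \<epsilon> where "\<epsilon> = (real a + b - 2 - s * K) / (2 * K)"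
  have "\<epsilon> > 0" using sK \<open>K > 0\<close> by (simp add: \<epsilon>_def)
  have "\<epsilon> * K = (real a + b - 2 - s * K) / 2" using \<open>K > 0\<close> by (simp add: \<epsilon>_def)
  then have "(s + \<epsilon>) * K < real a + b - 2" using sK by (simp add: distrib_right)
  then have "a * ((s + \<epsilon>) * p) + b * ((s + \<epsilon>) * q) < real a + b - 2"
    by (simp add: K_def algebra_simps)
  moreover have "(real b + s - 2) * ((s + \<epsilon>) * p) = s + \<epsilon>" "(real a + s - 2) * ((s + \<epsilon>) * q) = s + \<epsilon>"
    using pq(3,4) by (metis mult.commute mult.left_commute mult_1_right)+
  moreover have "(s + \<epsilon>) * p > 0" "(s + \<epsilon>) * q > 0" using pq(1,2) \<open>\<epsilon> > 0\<close> by simp_all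
  ultimately show thesis using \<open>\<epsilon> > 0\<close> that[of "(s + \<epsilon>) * p" "(s + \<epsilon>) * q"] by linarith
qed

text \<open>Supersolution conditions for \<open>c = n - 3\<close> when \<open>A\<close> has two
  vertices and an edge \<open>uv\<close> is missing in \<open>S \<union> B\<close>. The first
  inequality serves \<open>A\<close>; \<open>s * \<sigma> < 2 * \<zeta>\<close> serves
  \<open>B\<close> and, with \<open>2 * \<alpha> \<le> (n - 2) * \<sigma>\<close>, also
  \<open>S\<close>; the last serves \<open>u\<close> and \<open>v\<close>, again with the help of
  the second if they lie in \<open>S\<close>.\<close>

lemma small_side_weights:
  fixes n s :: nat
  assumes "s \<ge> 1" "s\<^sup>2 + 6 \<le> n"
  obtains \<alpha> \<sigma> \<zeta> :: real where "\<alpha> > 0" "\<sigma> > 0" "0 < \<zeta>" "\<zeta> < 1"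
    "s * (1 + \<sigma>) < (real n - 4) * \<alpha>" "2 * \<alpha> \<le> (real n - 2) * \<sigma>"
    "s * \<sigma> < 2 * \<zeta>" "(real n - 3) * \<zeta> + s * \<sigma> < 1"
proof -
  have n: "real s ^ 2 + 6 \<le> n" using of_nat_mono[OF assms(2), where ?'a = real] by simp
  have s: "real s \<ge> 1" using assms(1) by simp
  have s2: "real s ^ 2 \<ge> 1" using s by simp
  have n7: "real n \<ge> 7" using n s2 by simp
  have "(real s - 1)\<^sup>2 \<ge> 0" by simp
  then have "2 * real s \<le> s ^ 2 + 1" by (simp add: power2_eq_square algebra_simps)
  then have sn: "2 * real s < real n - 2" using n by simp
  \<comment> \<open>The weights will solve \<open>(n - 5) * \<alpha> = s\<close> and
    \<open>(n - 2) * \<sigma> = 2 * \<alpha>\<close>, so \<open>D\<close> is the denominator of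
    \<sigma>. Using \<open>n - 5\<close> where the first condition has \<open>n - 4\<close> leaves
    room \<alpha> for the term \<open>s * \<sigma>\<close>, which is smaller because
    \<open>2 * s < n - 2\<close>.\<close>
  define D where "D = (real n - 2) * (real n - 5)"
  have D: "D > 0" using n7 by (simp add: D_def)
  \<comment> \<open>\<open>\<zeta>\<close> is slightly larger than \<open>s \<sigma> / 2\<close>; since \<open>s\<^sup>2 \<le> n - 6\<close>, the last bound then reduces to
    \<open>(n - 1) (n - 6) + 3 < (n - 2) (n - 5)\<close>.\<close>
  define \<alpha> \<sigma> \<zeta> where "\<alpha> = s / (real n - 5)" and "\<sigma> = 2 * s / D"
    and "\<zeta> = (s ^ 2 + 3 / (real n - 3)) / D"
  have \<alpha>: "\<alpha> > 0" "(real n - 5) * \<alpha> = s" and \<sigma>: "\<sigma> > 0" and \<zeta>: "\<zeta> > 0"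
    using s n7 D by (auto simp: \<alpha>_def \<sigma>_def \<zeta>_def intro!: divide_pos_pos add_pos_pos)
  have \<sigma>\<alpha>: "(real n - 2) * \<sigma> = 2 * \<alpha>"
    using n7 by (simp add: \<sigma>_def \<alpha>_def D_def)
  have "s * (2 * \<alpha>) < (real n - 2) * \<alpha>" using mult_strict_right_mono[OF sn \<alpha>(1)] by (simp add: mult_ac)
  then have "(real n - 2) * (s * \<sigma>) < (real n - 2) * \<alpha>" using \<sigma>\<alpha> by (metis mult.left_commute)
  then have "s * \<sigma> < \<alpha>" using n7 by simp
  then have 1: "s * (1 + \<sigma>) < (real n - 4) * \<alpha>" using \<alpha>(2) by (simp add: algebra_simps)
  have s\<sigma>: "s * \<sigma> = 2 * s ^ 2 / D" by (simp add: \<sigma>_def power2_eq_square)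
  have 3: "s * \<sigma> < 2 * \<zeta>"
    unfolding s\<sigma> using D n7 by (simp add: \<zeta>_def divide_strict_right_mono flip: add_divide_distrib)
  have "(real n - 3) * (3 / (real n - 3)) = 3"
    using n7 by (intro nonzero_mult_div_cancel_left[THEN trans[OF times_divide_eq_right]]) linarith
  then have "(real n - 3) * \<zeta> = ((real n - 3) * s ^ 2 + 3) / D"
    by (simp only: \<zeta>_def times_divide_eq_right[symmetric] distrib_left) (simp add: distrib_left)
  then have "(real n - 3) * \<zeta> + s * \<sigma> = ((real n - 1) * s ^ 2 + 3) / D"
    unfolding s\<sigma> by (simp add: algebra_simps flip: add_divide_distrib)
  moreover have "(real n - 1) * s ^ 2 \<le> (real n - 1) * (real n - 6)"
    using n n7 by (intro mult_left_mono) auto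
  then have "(real n - 1) * s ^ 2 + 3 < D" by (simp add: D_def algebra_simps)
  ultimately have 4: "(real n - 3) * \<zeta> + s * \<sigma> < 1" using D by simp
  have "1 * \<zeta> \<le> (real n - 3) * \<zeta>" using n7 \<zeta> by (intro mult_right_mono) auto
  moreover have "s * \<sigma> \<ge> 0" using \<sigma> by simp
  ultimately have "\<zeta> < 1" using 4 by linarith
  then show thesis using that[of \<alpha> \<sigma> \<zeta>] \<alpha> \<sigma> \<zeta> 1 3 4 \<sigma>\<alpha> by simp
qed

section \<open>Graphs with a separating set\<close>

text \<open>Each side may consist of several components of the graph without \<open>S\<close>. By
  symmetry of the arcs, \<open>B\<close> to \<open>A\<close> is excluded too, so the sides can be
  exchanged and facts about \<open>A\<close> transfer to \<open>B\<close>.\<close>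

locale separated_graph = pair_graph G for G :: "'a pair_pre_digraph" +
  fixes S A B :: "'a set"
  assumes verts_partition: "pverts G = S \<union> A \<union> B"
    and disjoint: "S \<inter> A = {}" "S \<inter> B = {}" "A \<inter> B = {}"
    and no_crossing: "parcs G \<inter> A \<times> B = {}"
begin

lemma arcs_sym: "(u, v) \<in> parcs G \<longleftrightarrow> (v, u) \<in> parcs G"
  using pair_sym_arcs by (auto simp: symmetric_def sym_def)

lemma separated_graph_swap: "separated_graph G S B A"
proof
  show "parcs G \<inter> B \<times> A = {}" using no_crossing arcs_sym by auto
qed (use verts_partition disjoint in auto)

lemma finite_parts [simp]: "finite S" "finite A" "finite B"
  using pair_finite_verts by (simp_all add: verts_partition)

lemma card_verts: "card (pverts G) = card S + card A + card B"
  using disjoint by (simp add: verts_partition card_Un_disjoint Int_Un_distrib2)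

lemma not_adj_self: "w \<notin> parcs G `` {w}"
  using pair_no_loops by fastforce

lemma neighbours_side: "w \<in> A \<Longrightarrow> parcs G `` {w} \<subseteq> S \<union> (A - {w})"
  using no_crossing not_adj_self in_arcsD2 by (fastforce simp: verts_partition)

lemma neighbours: "parcs G `` {w} \<subseteq> S \<union> A \<union> B - {w}"
  using not_adj_self in_arcsD2 by (fastforce simp: verts_partition)

lemma degree_side_le: "w \<in> A \<Longrightarrow> card (parcs G `` {w}) \<le> card S + (card A - 1)"
  using card_mono[OF _ neighbours_side[of w]] card_Un_le[of S "A - {w}"]
  by (simp add: card_Diff_singleton)

text \<open>Missing edges only decrease neighbour sums of a positive vector, so each vertex is
  treated as adjacent to everything the separation permits. The conditions are then those of
  \<open>two_sided_weights\<close>.\<close>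

lemma spectral_radius_two_large_sides:
  assumes "card A \<ge> 3" "card B \<ge> 3" "(card S)\<^sup>2 + 6 \<le> card (pverts G)"
  shows "graph_spectral_radius G < real (card (pverts G)) - 3"
proof -
  have "(card S)\<^sup>2 + 6 \<le> card A + card B + card S" using assms(3) by (simp add: card_verts)
  from two_sided_weights[OF assms(1,2) this] obtain \<alpha> \<beta> :: real where
    w: "\<alpha> > 0" "\<beta> > 0" "card S < (real (card B) + card S - 2) * \<alpha>"
      "card S < (real (card A) + card S - 2) * \<beta>"
      "card A * \<alpha> + card B * \<beta> < real (card A) + card B - 2" .
  define y where "y v = (if v \<in> A then \<alpha> else if v \<in> B then \<beta> else 1)" for v
  have pos: "y v > 0" for v using w by (simp add: y_def)
  have sums: "sum y S = card S" "sum y A = card A * \<alpha>" "sum y B = card B * \<beta>"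
  proof -
    have "sum y S = (\<Sum>_\<in>S. 1)" "sum y A = (\<Sum>_\<in>A. \<alpha>)" "sum y B = (\<Sum>_\<in>B. \<beta>)"
      using disjoint by (intro sum.cong; auto simp: y_def)+
    then show "sum y S = card S" "sum y A = card A * \<alpha>" "sum y B = card B * \<beta>" by simp_all
  qed
  show ?thesis
  proof (rule graph_spectral_radius_less_if_supersolution[where y = y])
    show "pair_graph G" by unfold_locales
    show "pverts G \<noteq> {}" using assms(1) by (auto simp: verts_partition)
    show "y v > 0" for v by (rule pos)
    fix v assume "v \<in> pverts G"
    then consider "v \<in> A" | "v \<in> B" | "v \<in> S" by (auto simp: verts_partition)
    then show "sum y (parcs G `` {v}) < (real (card (pverts G)) - 3) * y v"
    proof cases
      case 1
      then have "sum y (parcs G `` {v}) \<le> sum y (S \<union> (A - {v}))"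
        using neighbours_side pos by (intro sum_mono2) (auto intro: less_imp_le)
      also have "\<dots> = card S + card A * \<alpha> - \<alpha>"
        using 1 disjoint by (subst sum.union_disjoint) (auto simp: sums sum_diff1, simp add: y_def)
      finally show ?thesis using 1 w by (simp add: y_def card_verts algebra_simps)
    next
      case 2
      then have "sum y (parcs G `` {v}) \<le> sum y (S \<union> (B - {v}))"
        using separated_graph.neighbours_side[OF separated_graph_swap] pos
        by (intro sum_mono2) (auto intro: less_imp_le)
      also have "\<dots> = card S + card B * \<beta> - \<beta>"
        using 2 disjoint by (subst sum.union_disjoint) (auto simp: sums sum_diff1, auto simp: y_def)
      finally show ?thesis using 2 w disjoint by (auto simp: y_def card_verts algebra_simps)
    next
      case 3
      then have "v \<notin> A" "v \<notin> B" using disjoint by auto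
      have "sum y (parcs G `` {v}) \<le> sum y (S \<union> A \<union> B - {v})"
        using neighbours pos by (intro sum_mono2) (auto intro: less_imp_le)
      also have "\<dots> = sum y (S \<union> A \<union> B) - y v"
        using 3 by (simp add: sum_diff1)
      also have "sum y (S \<union> A \<union> B) = card S + card A * \<alpha> + card B * \<beta>"
        using disjoint by (simp add: sum.union_disjoint Int_Un_distrib2 sums)
      finally show ?thesis using w \<open>v \<notin> A\<close> \<open>v \<notin> B\<close> by (simp add: y_def card_verts)
    qed
  qed
qed

text \<open>Raising \<open>S\<close> by \<sigma> pays for its neighbours in \<open>A\<close> but
  adds \<open>s * \<sigma>\<close> to the total over \<open>S \<union> B\<close>. Lowering
  \<open>u\<close> and \<open>v\<close> by \<zeta> more than cancels this. These two vertices can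
  afford smaller entries because each misses the other as a neighbour.\<close>

lemma spectral_radius_missing_edge:
  assumes "card A = 2" "S \<noteq> {}" "(card S)\<^sup>2 + 6 \<le> card (pverts G)"
    and uv: "u \<in> S \<union> B" "v \<in> S \<union> B" "u \<noteq> v" "(u, v) \<notin> parcs G"
  shows "graph_spectral_radius G < real (card (pverts G)) - 3"
proof -
  define n s where "n = card (pverts G)" and "s = card S"
  have "s \<ge> 1" using assms(2) by (simp add: s_def Suc_le_eq card_gt_0_iff)
  moreover have "s\<^sup>2 + 6 \<le> n" using assms(3) by (simp add: s_def n_def)
  ultimately obtain \<alpha> \<sigma> \<zeta> :: real where
    w: "\<alpha> > 0" "\<sigma> > 0" "0 < \<zeta>" "\<zeta> < 1"
      "s * (1 + \<sigma>) < (real n - 4) * \<alpha>" "2 * \<alpha> \<le> (real n - 2) * \<sigma>"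
      "s * \<sigma> < 2 * \<zeta>" "(real n - 3) * \<zeta> + s * \<sigma> < 1"
    by (rule small_side_weights)
  define C where "C = S \<union> B"
  have C: "finite C" "C \<inter> A = {}" "u \<in> C" "v \<in> C" using disjoint uv by (auto simp: C_def)
  have "card C = card S + card B" unfolding C_def using disjoint by (simp add: card_Un_disjoint)
  then have card_C: "real (card C) = real n - 2" using assms(1) by (simp add: n_def card_verts)
  define y where "y x = (if x \<in> A then \<alpha>
    else 1 + (if x \<in> S then \<sigma> else 0) - (if x = u \<or> x = v then \<zeta> else 0))" for x
  have pos: "y x > 0" for x using w by (simp add: y_def)
  have nonneg: "y x \<ge> 0" for x using pos[of x] by simp
  have y_C: "y x = 1 + (if x \<in> S then \<sigma> else 0) - (if x = u \<or> x = v then \<zeta> else 0)"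
    if "x \<in> C" for x using that C by (auto simp: y_def)
  have sum_A: "sum y A = 2 * \<alpha>" using assms(1) by (simp add: y_def)
  \<comment> \<open>Membership in \<open>{u, v}\<close> replaces the disjunction so that each
    correction becomes a sum over an intersection with \<open>C\<close>.\<close>
  have "sum y C = (\<Sum>x\<in>C. 1 + (if x \<in> S then \<sigma> else 0) - (if x \<in> {u, v} then \<zeta> else 0))"
    by (intro sum.cong) (auto simp: y_C)
  also have "\<dots> = card C + s * \<sigma> - 2 * \<zeta>"
  proof -
    have "C \<inter> S = S" "C \<inter> {u, v} = {u, v}" using C by (auto simp: C_def)
    moreover have "card {u, v} = 2" using uv(3) by simp
    ultimately show ?thesis using C(1)
      by (simp add: sum.distrib sum_subtractf s_def sum.If_cases del: insert_iff)
  qed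
  finally have sum_C: "sum y C = real n - 2 + s * \<sigma> - 2 * \<zeta>" by (simp add: card_C)
  \<comment> \<open>Stated for either end \<open>p\<close> of the missing edge, with
    \<open>q\<close> the other. Whether \<open>p\<close> lies in \<open>S\<close> decides if it can
    see \<open>A\<close>; for \<open>q\<close> the lower bound \<open>1 - \<zeta>\<close> is enough
    in both cases.\<close>
  have missing: "sum y (parcs G `` {p}) < (real n - 3) * y p"
    if pq: "p \<in> C" "q \<in> C" "p \<noteq> q" "{p, q} = {u, v}" "(p, q) \<notin> parcs G" for p q
  proof -
    have yp: "y p = 1 + (if p \<in> S then \<sigma> else 0) - \<zeta>" "y q \<ge> 1 - \<zeta>"
      using pq w by (auto simp: y_C doubleton_eq_iff)
    have "sum y (parcs G `` {p}) \<le> sum y ((C - {p} - {q}) \<union> (if p \<in> S then A else {}))"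
    proof (rule sum_mono2)
      have "p \<in> B" if "p \<notin> S" using that pq(1) by (auto simp: C_def)
      then show "parcs G `` {p} \<subseteq> (C - {p} - {q}) \<union> (if p \<in> S then A else {})"
        using neighbours[of p] separated_graph.neighbours_side[OF separated_graph_swap, of p] pq(5)
        by (auto simp: C_def)
    qed (use C nonneg in auto)
    also have "\<dots> = sum y C - y p - y q + (if p \<in> S then 2 * \<alpha> else 0)"
      using C pq by (subst sum.union_disjoint) (auto simp: sum_diff1 sum_A)
    also have "\<dots> < (real n - 3) * y p"
      using w yp(2) unfolding sum_C yp(1) by (cases "p \<in> S") (auto simp: algebra_simps)
    finally show ?thesis .
  qed
  have "graph_spectral_radius G < real n - 3"
  proof (rule graph_spectral_radius_less_if_supersolution[where y = y])
    show "pair_graph G" by unfold_locales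
    show "pverts G \<noteq> {}" using uv by (auto simp: verts_partition)
    show "y x > 0" for x by (rule pos)
    fix x assume "x \<in> pverts G"
    then consider "x \<in> A" | "x = u" | "x = v" | "x \<in> S" "x \<noteq> u" "x \<noteq> v" | "x \<in> B" "x \<noteq> u" "x \<noteq> v"
      by (auto simp: verts_partition)
    then show "sum y (parcs G `` {x}) < (real n - 3) * y x"
    proof cases
      case 1
      then have "sum y (parcs G `` {x}) \<le> sum y (S \<union> (A - {x}))"
        using neighbours_side nonneg by (intro sum_mono2) auto
      also have "\<dots> = sum y S + \<alpha>"
        using 1 disjoint assms(1) by (subst sum.union_disjoint) (auto simp: y_def)
      also have "sum y S \<le> s * (1 + \<sigma>)"
      proof -
        have "y z \<le> 1 + \<sigma>" if "z \<in> S" for z using that w y_C by (auto simp: C_def)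
        then show ?thesis using sum_bounded_above[of S y "1 + \<sigma>"] by (simp add: s_def)
      qed
      finally show ?thesis using 1 w by (simp add: y_def algebra_simps)
    next
      case 2
      then show ?thesis using missing[of u v] C uv by simp
    next
      case 3
      then show ?thesis using missing[of v u] C uv arcs_sym[of u v] by (simp add: insert_commute)
    next
      case 4
      then have x: "x \<in> C" "y x = 1 + \<sigma>" using y_C by (auto simp: C_def)
      have "sum y (parcs G `` {x}) \<le> sum y ((C - {x}) \<union> A)"
        using neighbours[of x] nonneg C by (intro sum_mono2) (auto simp: C_def)
      also have "\<dots> = sum y C - y x + 2 * \<alpha>"
        using C x by (subst sum.union_disjoint) (auto simp: sum_diff1 sum_A)
      finally show ?thesis using w unfolding x(2) sum_C by (simp add: algebra_simps)
    next
      case 5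
      then have x: "x \<in> C" "y x = 1" using y_C disjoint by (auto simp: C_def)
      have "sum y (parcs G `` {x}) \<le> sum y (C - {x})"
        using separated_graph.neighbours_side[OF separated_graph_swap 5(1)] nonneg C 5(1) disjoint(2)
        by (intro sum_mono2) (auto simp: C_def)
      also have "\<dots> = sum y C - y x"
        using C x by (auto simp: sum_diff1)
      finally show ?thesis using w unfolding x(2) sum_C by (simp add: algebra_simps)
    qed
  qed
  then show ?thesis by (simp add: n_def)
qed

text \<open>The hypotheses fix all arcs: neighbourhoods of \<open>A\<close> are given exactly, and
  \<open>S \<union> B\<close> is a clique. Numbering the three parts separately and placing them in
  the matching summands gives the isomorphism.\<close>

lemma digraph_iso_join_if_all_edges:
  assumes A: "\<And>x. x \<in> A \<Longrightarrow> parcs G `` {x} = S \<union> (A - {x})"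
    and SB: "\<And>u v. u \<in> S \<union> B \<Longrightarrow> v \<in> S \<union> B \<Longrightarrow> u \<noteq> v \<Longrightarrow> (u, v) \<in> parcs G"
  shows "digraph_iso (with_proj G)
    (with_proj (graph_join (complete_graph (card S))
      (disjoint_union (complete_graph (card A)) (complete_graph (card B)))))"
    (is "digraph_iso _ (with_proj ?H)")
proof -
  obtain g h k where
    g: "bij_betw g S {..<card S}" and h: "bij_betw h A {..<card A}" and k: "bij_betw k B {..<card B}"
    using ex_bij_betw_finite_nat[of S] ex_bij_betw_finite_nat[of A] ex_bij_betw_finite_nat[of B]
    by (auto simp: atLeast0LessThan)
  define f where "f x = (if x \<in> S then Inl (g x) else if x \<in> A then Inr (Inl (h x)) else Inr (Inr (k x)))"
    for x
  have f: "\<And>x. x \<in> S \<Longrightarrow> f x = Inl (g x)" "\<And>x. x \<in> A \<Longrightarrow> f x = Inr (Inl (h x))"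
    "\<And>x. x \<in> B \<Longrightarrow> f x = Inr (Inr (k x))"
    using disjoint by (auto simp: f_def)
  have inj: "inj_on g S" "inj_on h A" "inj_on k B"
    and im: "g ` S = {..<card S}" "h ` A = {..<card A}" "k ` B = {..<card B}"
    using g h k by (auto simp: bij_betw_def)
  have verts_H: "pverts ?H = {..<card S} <+> ({..<card A} <+> {..<card B})"
    by (simp add: graph_join_def disjoint_union_def complete_graph_def)
  show ?thesis
  proof (rule digraph_iso_with_projI)
    show "wf_digraph (with_proj G)" by (rule wf_digraph)
    show "bij_betw f (pverts G) (pverts ?H)"
      unfolding bij_betw_def
    proof
      show "inj_on f (pverts G)"
        unfolding verts_partition f_def
        by (intro inj_onI) (use inj in \<open>auto split: if_splits dest: inj_onD\<close>)
      have "f ` S = Inl ` g ` S" "f ` A = Inr ` Inl ` h ` A" "f ` B = Inr ` Inr ` k ` B"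
        using f by (auto simp: image_image intro!: image_cong)
      then show "f ` pverts G = pverts ?H"
        unfolding verts_partition verts_H im by (simp add: image_Un Plus_def Un_assoc)
    qed
    show "parcs ?H \<subseteq> pverts ?H \<times> pverts ?H"
    proof clarify
      fix p q assume "(p, q) \<in> parcs ?H"
      then show "p \<in> pverts ?H \<and> q \<in> pverts ?H"
        unfolding verts_H graph_join_def disjoint_union_def complete_graph_def by auto
    qed
    fix u v assume "u \<in> pverts G" "v \<in> pverts G"
    have A_iff: "(u, v) \<in> parcs G \<longleftrightarrow> v \<in> S \<or> v \<in> A \<and> v \<noteq> u" if "u \<in> A" for u v
      using A[OF that] by blast
    have A_iff': "(u, v) \<in> parcs G \<longleftrightarrow> u \<in> S \<or> u \<in> A \<and> u \<noteq> v" if "v \<in> A" for u v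
      using A_iff[OF that] arcs_sym by metis
    have SB_iff: "(u, v) \<in> parcs G \<longleftrightarrow> u \<noteq> v" if "u \<in> S \<union> B" "v \<in> S \<union> B" for u v
      using SB[OF that] not_adj_self by auto
    have lt: "\<And>x. x \<in> S \<Longrightarrow> g x < card S" "\<And>x. x \<in> A \<Longrightarrow> h x < card A" "\<And>x. x \<in> B \<Longrightarrow> k x < card B"
      using im by blast+
    have eq: "\<And>x y. x \<in> S \<Longrightarrow> y \<in> S \<Longrightarrow> g x = g y \<longleftrightarrow> x = y"
      "\<And>x y. x \<in> A \<Longrightarrow> y \<in> A \<Longrightarrow> h x = h y \<longleftrightarrow> x = y"
      "\<And>x y. x \<in> B \<Longrightarrow> y \<in> B \<Longrightarrow> k x = k y \<longleftrightarrow> x = y"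
      using inj by (auto simp: inj_on_eq_iff)
    note facts = f lt eq parcs_disjoint_union parcs_graph_join complete_graph_def disjoint_union_def
    \<comment> \<open>Pairs that meet \<open>A\<close> are decided by its neighbourhoods, read from
      either end; all remaining pairs lie in the clique.\<close>
    consider "u \<in> A" | "v \<in> A" "u \<in> S \<union> B" | "u \<in> S \<union> B" "v \<in> S \<union> B"
      using \<open>u \<in> pverts G\<close> \<open>v \<in> pverts G\<close> by (auto simp: verts_partition)
    then show "(f u, f v) \<in> parcs ?H \<longleftrightarrow> (u, v) \<in> parcs G"
    proof cases
      case 1
      show ?thesis
        unfolding A_iff[OF 1] using \<open>v \<in> pverts G\<close>[unfolded verts_partition] 1 disjoint
        by (elim UnE) (auto simp: facts)
    next
      case 2
      show ?thesis
        unfolding A_iff'[OF 2(1)] using 2(2,1) disjoint by (elim UnE) (auto simp: facts)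
    next
      case 3
      show ?thesis
        unfolding SB_iff[OF 3] using 3 disjoint by (elim UnE) (auto simp: facts)
    qed
  qed
qed

end

section \<open>Minimum separating sets\<close>

lemma min_degree_le:
  assumes "pair_graph G" "v \<in> pverts G"
  shows "min_degree G \<le> card (parcs G `` {v})"
  using assms pair_fin_digraph.pair_finite_verts[of G]
  by (auto simp: min_degree_def out_degree_with_proj pair_graph_def pair_digraph_def intro!: Min_le)

lemma min_degree_attained:
  assumes "pair_graph G" "pverts G \<noteq> {}"
  obtains v where "v \<in> pverts G" "min_degree G = card (parcs G `` {v})"
proof -
  interpret pair_graph G by fact
  have "min_degree G \<in> out_degree (with_proj G) ` pverts G"
    unfolding min_degree_def using assms(2) pair_finite_verts by (intro Min_in) auto
  then show thesis using that by (auto simp: out_degree_with_proj)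
qed

lemma vertex_connectivity_complete:
  assumes "complete_digraph (card (pverts G)) (with_proj G)" "pverts G \<noteq> {}"
  shows "vertex_connectivity G = min_degree G"
proof -
  have G: "finite (pverts G)" "parcs G = {(u, v). u \<in> pverts G \<and> v \<in> pverts G \<and> u \<noteq> v}"
    using assms(1) unfolding complete_digraph_pair_def by auto
  have "out_degree (with_proj G) v = card (pverts G) - 1" if "v \<in> pverts G" for v
  proof -
    have "parcs G `` {v} = pverts G - {v}" using that by (auto simp: G(2))
    then show ?thesis using that by (simp add: out_degree_with_proj card_Diff_singleton)
  qed
  then have "out_degree (with_proj G) ` pverts G = {card (pverts G) - 1}"
    using assms(2) by auto
  then show ?thesis using assms(1) by (simp add: vertex_connectivity_def min_degree_def)
qed

text \<open>The neighbourhood of a vertex \<open>v\<close> of minimum degree separates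
  \<open>v\<close> from some non-neighbour. This bounds the connectivity and shows that the minimum
  is over a nonempty family, hence attained by some \<open>S\<close>.\<close>

lemma vertex_connectivity_noncomplete:
  assumes G: "pair_graph G" and nc: "\<not> complete_digraph (card (pverts G)) (with_proj G)"
  shows vertex_connectivity_le_min_degree: "vertex_connectivity G \<le> min_degree G"
    and vertex_connectivity_separation: "\<exists>S A B. separated_graph G S A B \<and> A \<noteq> {} \<and> B \<noteq> {} \<and>
      card S = vertex_connectivity G"
proof -
  interpret pair_graph G by fact
  let ?F = "{S. S \<subset> pverts G \<and> \<not> Digraph_Component.connected (with_proj G \<restriction> (pverts G - S))}"
  have \<kappa>: "vertex_connectivity G = Min (card ` ?F)"
    using nc by (simp add: vertex_connectivity_def)
  have "finite ?F"
    by (rule finite_subset[of _ "Pow (pverts G)"]) (use pair_finite_verts in auto)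
  obtain x y where xy: "x \<in> pverts G" "y \<in> pverts G" "x \<noteq> y" "(x, y) \<notin> parcs G"
  proof -
    have "parcs G \<noteq> {(u, v). (u, v) \<in> pverts G \<times> pverts G \<and> u \<noteq> v}"
      using nc pair_finite_verts unfolding complete_digraph_pair_def by blast
    moreover have "parcs G \<subseteq> {(u, v). (u, v) \<in> pverts G \<times> pverts G \<and> u \<noteq> v}"
      using pair_no_loops in_arcsD1 in_arcsD2 by fastforce
    ultimately show thesis using that by blast
  qed
  then obtain v where v: "v \<in> pverts G" "min_degree G = card (parcs G `` {v})"
    using min_degree_attained[OF G] by blast
  have N: "parcs G `` {z} \<subseteq> pverts G - {z}" for z
    using pair_no_loops in_arcsD2 by fastforce
  \<comment> \<open>If \<open>v\<close> were adjacent to all other vertices, the minimum degree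
    would be one less than the order, but \<open>x\<close> misses both itself and
    \<open>y\<close>.\<close>
  have "\<exists>w \<in> pverts G. w \<noteq> v \<and> w \<notin> parcs G `` {v}"
  proof (rule ccontr)
    assume "\<not> ?thesis"
    then have "parcs G `` {v} = pverts G - {v}" using N[of v] by auto
    then have "card (parcs G `` {v}) = card (pverts G) - 1" using v by (simp add: card_Diff_singleton)
    moreover have "card (parcs G `` {x}) \<le> card (pverts G - {x} - {y})"
      using N[of x] xy pair_finite_verts by (intro card_mono) auto
    moreover have "card (pverts G - {x} - {y}) = card (pverts G) - 2"
      using xy by (simp add: card_Diff_singleton)
    moreover have "card (pverts G) \<ge> 2"
      using card_mono[OF pair_finite_verts, of "{x, y}"] xy by simp
    ultimately show False using v(2) min_degree_le[OF G xy(1)] by linarith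
  qed
  then obtain w where w: "w \<in> pverts G" "w \<noteq> v" "w \<notin> parcs G `` {v}" by blast
  have F: "parcs G `` {v} \<in> ?F"
  proof (intro CollectI conjI notI)
    show "parcs G `` {v} \<subset> pverts G" using N[of v] v by auto
    assume c: "Digraph_Component.connected (with_proj G \<restriction> (pverts G - parcs G `` {v}))"
    have "{v} \<subseteq> pverts G - parcs G `` {v}" using N[of v] v by auto
    moreover have "parcs G \<inter> {v} \<times> (pverts G - parcs G `` {v} - {v}) = {}" by auto
    ultimately have "{v} = pverts G - parcs G `` {v}"
      using c unfolding connected_induce_subgraph_iff[OF G] by blast
    then show False using w by blast
  qed
  then show "vertex_connectivity G \<le> min_degree G"
    unfolding \<kappa> v(2) using \<open>finite ?F\<close> by (intro Min_le) auto
  have "vertex_connectivity G \<in> card ` ?F"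
    unfolding \<kappa> using \<open>finite ?F\<close> F by (intro Min_in) auto
  then obtain S where "vertex_connectivity G = card S" "S \<in> ?F" by (rule imageE)
  then have S: "card S = vertex_connectivity G" "S \<subset> pverts G"
    "\<not> Digraph_Component.connected (with_proj G \<restriction> (pverts G - S))" by simp_all
  moreover have "pverts G - S \<noteq> {}" using S(2) by auto
  ultimately obtain A where A: "A \<subseteq> pverts G - S" "A \<noteq> {}"
    "parcs G \<inter> A \<times> (pverts G - S - A) = {}" "A \<noteq> pverts G - S"
    unfolding connected_induce_subgraph_iff[OF G] by blast
  have "separated_graph G S A (pverts G - S - A)"
    by unfold_locales (use S(2) A in auto)
  then show "\<exists>S A B. separated_graph G S A B \<and> A \<noteq> {} \<and> B \<noteq> {} \<and> card S = vertex_connectivity G"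
    using S(1) A by (intro exI[of _ S] exI[of _ A] exI[of _ "pverts G - S - A"]) auto
qed

text \<open>A vertex of \<open>A\<close> has at most \<open>card S + 1\<close> neighbours and at
  least \<open>min_degree G > card S\<close>. So equality holds throughout, which fixes
  \<open>card S\<close> and the neighbourhoods of \<open>A\<close>; the bound on \<rho> excludes
  missing edges in \<open>S \<union> B\<close>.\<close>

lemma (in separated_graph) digraph_iso_join_if_small_side:
  assumes \<delta>: "min_degree G \<ge> 2" "card S < min_degree G" and A: "card A = 2"
    and n: "(card S)\<^sup>2 + 6 \<le> card (pverts G)"
    and \<rho>: "graph_spectral_radius G \<ge> real (card (pverts G)) - 3"
  shows "digraph_iso (with_proj G)
    (with_proj (graph_join (complete_graph (min_degree G - 1))
      (disjoint_union (complete_graph 2) (complete_graph (card (pverts G) - min_degree G - 1)))))"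
proof -
  have G: "pair_graph G" by unfold_locales
  have deg: "min_degree G \<le> card (parcs G `` {x})" if "x \<in> A" for x
    using that min_degree_le[OF G] by (simp add: verts_partition)
  obtain x where "x \<in> A" using A by fastforce
  then have S: "card S = min_degree G - 1"
    using deg degree_side_le[of x] A \<delta>(2) by fastforce
  then have "S \<noteq> {}" using \<delta>(1) by auto
  have "parcs G `` {x} = S \<union> (A - {x})" if "x \<in> A" for x
  proof (rule card_seteq)
    have "card (S \<union> (A - {x})) \<le> card S + 1"
      using card_Un_le[of S "A - {x}"] A that by simp
    then show "card (S \<union> (A - {x})) \<le> card (parcs G `` {x})"
      using deg[OF that] S \<delta>(1) by simp
  qed (use neighbours_side[OF that] in auto)
  moreover have "(u, v) \<in> parcs G" if "u \<in> S \<union> B" "v \<in> S \<union> B" "u \<noteq> v" for u v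
    using spectral_radius_missing_edge[OF A \<open>S \<noteq> {}\<close> n that] \<rho> by fastforce
  moreover have "card B = card (pverts G) - min_degree G - 1"
    using S A \<delta>(1) by (simp add: card_verts)
  ultimately show ?thesis using digraph_iso_join_if_all_edges S A by simp
qed

theorem theorem3p4:
  fixes G :: "'a pair_pre_digraph" and n \<delta> \<kappa> :: nat
  assumes "pair_graph G"
    and "Digraph_Component.connected (with_proj G)"
    and "n = card (pverts G)"
    and "\<delta> = min_degree G"
    and "\<delta> \<ge> 2"
    and "\<kappa> = vertex_connectivity G"
    and "int n \<ge> (int \<delta>)\<^sup>2 - 2 * int \<delta> + 7"
    and "graph_spectral_radius G \<ge> real n - 3"
  shows "\<kappa> = \<delta> \<or>
    digraph_iso (with_proj G)
      (with_proj (graph_join (complete_graph (\<delta> - 1))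
        (disjoint_union (complete_graph 2) (complete_graph (n - \<delta> - 1)))))"
proof (rule disjCI)
  assume not_iso: "\<not> digraph_iso (with_proj G)
      (with_proj (graph_join (complete_graph (\<delta> - 1))
        (disjoint_union (complete_graph 2) (complete_graph (n - \<delta> - 1)))))"
  show "\<kappa> = \<delta>"
  proof (rule ccontr)
    assume "\<kappa> \<noteq> \<delta>"
    \<comment> \<open>The hypothesis on \<open>n\<close> with the square completed;
      \<open>\<delta> \<ge> 2\<close> makes the subtraction on naturals exact.\<close>
    have n: "(\<delta> - 1)\<^sup>2 + 6 \<le> n"
    proof -
      have "int ((\<delta> - 1)\<^sup>2 + 6) = (int \<delta>)\<^sup>2 - 2 * int \<delta> + 7"
        using \<open>\<delta> \<ge> 2\<close> by (simp add: of_nat_diff power2_diff)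
      then show ?thesis using assms(7) by linarith
    qed
    then have "pverts G \<noteq> {}" using assms(3) by auto
    then have nc: "\<not> complete_digraph (card (pverts G)) (with_proj G)"
      using vertex_connectivity_complete \<open>\<kappa> \<noteq> \<delta>\<close> assms(4,6) by blast
    obtain S A B where sep: "separated_graph G S A B" and ne: "A \<noteq> {}" "B \<noteq> {}" and S: "card S = \<kappa>"
      using vertex_connectivity_separation[OF assms(1) nc] assms(6) by blast
    have "card S < \<delta>"
      using vertex_connectivity_le_min_degree[OF assms(1) nc] \<open>\<kappa> \<noteq> \<delta>\<close> S assms(4,6) by simp
    \<comment> \<open>Since \<open>card S \<le> \<delta> - 1\<close>, the size bound passes to
      \<open>card S\<close>, the form used by the spectral estimates.\<close>
    then have "(card S)\<^sup>2 \<le> (\<delta> - 1)\<^sup>2" by (intro power_mono) auto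
    then have Sn: "(card S)\<^sup>2 + 6 \<le> card (pverts G)" using n assms(3) by linarith
    \<comment> \<open>A vertex of degree at least \<delta> > \<open>card S\<close> needs a neighbour
      on its own side. The sides are generalised so that the fact also applies after exchanging
      them.\<close>
    have side: "card A \<ge> 2" if "separated_graph G S A B" "A \<noteq> {}" for A B
    proof -
      interpret separated_graph G S A B by fact
      obtain x where "x \<in> A" using \<open>A \<noteq> {}\<close> by blast
      then have "\<delta> \<le> card S + (card A - 1)"
        using degree_side_le[of x] min_degree_le[OF assms(1), of x] assms(4)
        by (simp add: verts_partition)
      then show ?thesis using \<open>card S < \<delta>\<close> by linarith
    qed
    note swap = separated_graph.separated_graph_swap[OF sep]
    note small = separated_graph.digraph_iso_join_if_small_side[OF _ _ _ _ Sn]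
    have "\<not> (card A \<ge> 3 \<and> card B \<ge> 3)"
      using separated_graph.spectral_radius_two_large_sides[OF sep _ _ Sn] assms(3,8) by fastforce
    then have "card A = 2 \<or> card B = 2" using side[OF sep ne(1)] side[OF swap ne(2)] by linarith
    then show False
      using not_iso small[OF sep] small[OF swap] \<open>card S < \<delta>\<close> assms(3,4,5,8) by auto
  qed
qed

end
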